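(* Let $E, F, E_1, E_2, F_1, F_2$ be Banach spaces over the same scalar field $\mathbb{K}$. (a) If $(E, F)$ has the WMP, then so does $(E, G)$ for every closed subspace $G$ of $F$. (b) If $(E, F)$ has the WMP, then so does $(E/M, F)$ for every closed subspace $M$ of $E$. In particular, $(M, F)$ has the WMP whenever $M$ is a $1$-complemented closed subspace of $E$. (c) If both $(E_1, F)$ and $(E_2, F)$ have the WMP, then so does $(E_1 \oplus_1 E_2, F)$. (d) If both $(E, F_1)$ and $(E, F_2)$ have the WMP, then so does $(E, F_1 \oplus_\infty F_2)$.
   Context: Banach spaces are over $\mathbb{K} = \mathbb{R}$ or $\mathbb{C}$. $E_1\oplus_1 E_2$ has norm $\|(x,y)\|=\|x\|+\|y\|$ and $F_1\oplus_\infty F_2$ has norm $\|(x,y)\|=\max\{\|x\|,\|y\|\}$. A closed subspace is $1$-complemented if it is the range of a linear projection of norm at most $1$. A bounded linear operator $T:E\to F$ attains its norm if there is $x_0$ in the unit sphere $S_E$ with $\|T(x_0)\|=\|T\|$. A maximizing sequence for $T$ is a sequence $(x_n)\subset S_E$ with $\|T(x_n)\|\to\|T\|$. A pair $(E,F)$ of Banach spaces has the weak maximizing property (WMP) if every bounded linear operator $T:E\to F$ that admits a non-weakly null maximizing sequence (i.e. one not converging weakly to $0$) attains its norm. *)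

theory Defs
  imports "HOL-Analysis.Analysis" "HOL-Algebra.Module" "HOL-Algebra.Algebraic_Closure_Type"
begin

text \<open>
  Subspaces, quotients and direct sums with prescribed norms are needed for arbitrary Banach
  spaces, so spaces are modules with an explicit carrier, extended by a norm. The scalar field
  \<open>\<bbbK>\<close> is a type \<open>'k\<close> of class \<^class>\<open>real_normed_field\<close>: the instances are \<^typ>\<open>real\<close> and
  \<^typ>\<open>complex\<close>, and by the Gelfand--Mazur theorem every type of this class is isometrically
  isomorphic to one of these two. The fields \<open>mult\<close> and \<open>one\<close> inherited from the library's
  module records play no role.
\<close>

record ('k, 'a) normed_module = "('k, 'a) module" +
  nrm :: "'a \<Rightarrow> real"

locale normed_space = module ring_of_type_algebra E
  for E :: "('k::real_normed_field, 'a) normed_module" (structure) +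
  assumes nrm_eq_0_iff: "x \<in> carrier E \<Longrightarrow> nrm E x = 0 \<longleftrightarrow> x = \<zero>"
    and nrm_triangle: "x \<in> carrier E \<Longrightarrow> y \<in> carrier E \<Longrightarrow> nrm E (x \<oplus> y) \<le> nrm E x + nrm E y"
    and nrm_smult: "x \<in> carrier E \<Longrightarrow> nrm E (c \<odot> x) = norm c * nrm E x"

text \<open>\<^locale>\<open>Metric_space\<close> wants symmetry and nonnegativity outside the carrier, too.\<close>

definition nrm_dist :: "('k, 'a) normed_module \<Rightarrow> 'a \<Rightarrow> 'a \<Rightarrow> real" where
  "nrm_dist E x y = (if x \<in> carrier E \<and> y \<in> carrier E then nrm E (x \<ominus>\<^bsub>E\<^esub> y) else 0)"

locale banach_space = normed_space E
  for E :: "('k::real_normed_field, 'a) normed_module" (structure) +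
  assumes complete: "Metric_space.mcomplete (carrier E) (nrm_dist E)"

definition closed_subspace :: "('k::real_normed_field, 'a) normed_module \<Rightarrow> 'a set \<Rightarrow> bool" where
  "closed_subspace E M \<longleftrightarrow> submodule M (ring_of_type_algebra :: 'k ring) E \<and>
     closedin (Metric_space.mtopology (carrier E) (nrm_dist E)) M"

text \<open>
  As for products of cosets in quotient rings, scalar multiples are unions of cosets: the plain
  image of a coset under \<open>c \<odot> _\<close> would be \<open>{\<zero>}\<close> rather than \<open>M\<close> for \<open>c = 0\<close>.
\<close>

definition quotient_space :: "('k, 'a) normed_module \<Rightarrow> 'a set \<Rightarrow> ('k, 'a set) normed_module" where
  "quotient_space E M =
     \<lparr>carrier = a_rcosets\<^bsub>E\<^esub> M, monoid.mult = undefined, one = undefined,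
      ring.zero = M, add = set_add E,
      smult = (\<lambda>c A. (\<Union>x\<in>A. M +>\<^bsub>E\<^esub> (c \<odot>\<^bsub>E\<^esub> x))),
      nrm = (\<lambda>A. (INF x\<in>A. nrm E x))\<rparr>"

definition sum_space ::
  "(real \<Rightarrow> real \<Rightarrow> real) \<Rightarrow> ('k, 'a) normed_module \<Rightarrow> ('k, 'b) normed_module
     \<Rightarrow> ('k, 'a \<times> 'b) normed_module" where
  "sum_space \<phi> E F =
     \<lparr>carrier = carrier E \<times> carrier F, monoid.mult = undefined, one = undefined,
      ring.zero = (\<zero>\<^bsub>E\<^esub>, \<zero>\<^bsub>F\<^esub>),
      add = (\<lambda>(x, y) (x', y'). (x \<oplus>\<^bsub>E\<^esub> x', y \<oplus>\<^bsub>F\<^esub> y')),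
      smult = (\<lambda>c (x, y). (c \<odot>\<^bsub>E\<^esub> x, c \<odot>\<^bsub>F\<^esub> y)),
      nrm = (\<lambda>(x, y). \<phi> (nrm E x) (nrm F y))\<rparr>"

abbreviation sum1_space (infixr \<open>\<oplus>\<^sub>1\<close> 65) where
  "E \<oplus>\<^sub>1 F \<equiv> sum_space (+) E F"

abbreviation sum_inf_space (infixr \<open>\<oplus>\<^sub>\<infinity>\<close> 65) where
  "E \<oplus>\<^sub>\<infinity> F \<equiv> sum_space max E F"

definition scalar_space :: "('k::real_normed_field, 'k) normed_module" where
  "scalar_space = \<lparr>carrier = UNIV, monoid.mult = (*), one = 1, ring.zero = 0, add = (+),
     smult = (*), nrm = norm\<rparr>"

text \<open>Operators are functions on the whole type; only their values on the carrier matter.\<close>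

definition bounded_operator ::
  "('k, 'a) normed_module \<Rightarrow> ('k, 'b) normed_module \<Rightarrow> ('a \<Rightarrow> 'b) \<Rightarrow> bool" where
  "bounded_operator E F T \<longleftrightarrow>
     T \<in> carrier E \<rightarrow> carrier F \<and>
     (\<forall>x\<in>carrier E. \<forall>y\<in>carrier E. T (x \<oplus>\<^bsub>E\<^esub> y) = T x \<oplus>\<^bsub>F\<^esub> T y) \<and>
     (\<forall>c. \<forall>x\<in>carrier E. T (c \<odot>\<^bsub>E\<^esub> x) = c \<odot>\<^bsub>F\<^esub> T x) \<and>
     (\<exists>C. \<forall>x\<in>carrier E. nrm F (T x) \<le> C * nrm E x)"

definition op_norm ::
  "('k, 'a) normed_module \<Rightarrow> ('k, 'b) normed_module \<Rightarrow> ('a \<Rightarrow> 'b) \<Rightarrow> real" where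
  "op_norm E F T = (SUP x\<in>{x \<in> carrier E. nrm E x \<le> 1}. nrm F (T x))"

definition one_complemented :: "('k::real_normed_field, 'a) normed_module \<Rightarrow> 'a set \<Rightarrow> bool" where
  "one_complemented E M \<longleftrightarrow>
     (\<exists>P. bounded_operator E E P \<and> (\<forall>x\<in>carrier E. P (P x) = P x) \<and>
          op_norm E E P \<le> 1 \<and> P ` carrier E = M)"

definition unit_sphere :: "('k, 'a) normed_module \<Rightarrow> 'a set" where
  "unit_sphere E = {x \<in> carrier E. nrm E x = 1}"

definition weakly_null :: "('k::real_normed_field, 'a) normed_module \<Rightarrow> (nat \<Rightarrow> 'a) \<Rightarrow> bool" where
  "weakly_null E x \<longleftrightarrow>
     (\<forall>f. bounded_operator E (scalar_space :: ('k, 'k) normed_module) f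
        \<longrightarrow> (\<lambda>n. f (x n)) \<longlonglongrightarrow> 0)"

definition attains_norm ::
  "('k, 'a) normed_module \<Rightarrow> ('k, 'b) normed_module \<Rightarrow> ('a \<Rightarrow> 'b) \<Rightarrow> bool" where
  "attains_norm E F T \<longleftrightarrow> (\<exists>x\<in>unit_sphere E. nrm F (T x) = op_norm E F T)"

definition maximizing_sequence ::
  "('k, 'a) normed_module \<Rightarrow> ('k, 'b) normed_module \<Rightarrow> ('a \<Rightarrow> 'b) \<Rightarrow> (nat \<Rightarrow> 'a) \<Rightarrow> bool" where
  "maximizing_sequence E F T x \<longleftrightarrow>
     range x \<subseteq> unit_sphere E \<and> (\<lambda>n. nrm F (T (x n))) \<longlonglongrightarrow> op_norm E F T"

definition WMP ::
  "('k::real_normed_field, 'a) normed_module \<Rightarrow> ('k, 'b) normed_module \<Rightarrow> bool" where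
  "WMP E F \<longleftrightarrow> banach_space E \<and> banach_space F \<and>
     (\<forall>T. bounded_operator E F T \<longrightarrow>
        (\<exists>x. maximizing_sequence E F T x \<and> \<not> weakly_null E x) \<longrightarrow> attains_norm E F T)"

end

theory Submission
  imports Defs
begin

text \<open>
  In each part, an operator \<open>T\<close> with a non-weakly null maximizing sequence is compared with an
  operator between spaces already known to have the WMP: \<open>T\<close> composed with an inclusion (a), with a
  quotient map or a projection (b), with the embedding of a summand (c) or with a coordinate
  projection (d). A functional witnessing that the original sequence is not weakly null also
  witnesses it for the induced sequence, along a subsequence. In (b) the sequence is lifted with
  almost the same norms; in (c) the component on which the functional stays away from \<open>0\<close> has
  norm bounded below, and \<open>\<parallel>T x\<parallel> \<le> \<parallel>T (u, 0)\<parallel> + \<parallel>T\<parallel> \<parallel>v\<parallel>\<close> for \<open>x = (u, v)\<close> makes it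
  asymptotically maximizing; in (d) one coordinate of \<open>T x\<^sub>n\<close> carries the maximum infinitely often.
\<close>

section \<open>Vector arithmetic and the metric of a normed space\<close>

context normed_space
begin

lemma smult_carrier [simp, intro]: "x \<in> carrier E \<Longrightarrow> c \<odot> x \<in> carrier E"
  using smult_closed[of c x] by (simp add: ring_of_type_algebra_def)

lemma add_smult: "x \<in> carrier E \<Longrightarrow> (a + b) \<odot> x = a \<odot> x \<oplus> b \<odot> x"
  using smult_l_distr[of a b x] by (simp add: ring_of_type_algebra_def)

lemma smult_add: "x \<in> carrier E \<Longrightarrow> y \<in> carrier E \<Longrightarrow> a \<odot> (x \<oplus> y) = a \<odot> x \<oplus> a \<odot> y"
  using smult_r_distr[of a x y] by (simp add: ring_of_type_algebra_def)

lemma smult_smult: "x \<in> carrier E \<Longrightarrow> a \<odot> (b \<odot> x) = (a * b) \<odot> x"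
  using smult_assoc1[of a b x] by (simp add: ring_of_type_algebra_def)

lemma one_smult [simp]: "x \<in> carrier E \<Longrightarrow> 1 \<odot> x = x"
  using smult_one[of x] by (simp add: ring_of_type_algebra_def)

lemma zero_smult [simp]: "x \<in> carrier E \<Longrightarrow> 0 \<odot> x = \<zero>"
  using smult_l_null[of x] by (simp add: ring_of_type_algebra_def)

text \<open>Expresses subtraction through the two operations that linear maps and the norm axioms
  speak about.\<close>

lemma minus_eq_smult:
  assumes "x \<in> carrier E" "y \<in> carrier E"
  shows "x \<ominus> y = x \<oplus> (- 1) \<odot> y"
proof -
  have "(- 1) \<odot> y \<oplus> y = \<zero>"
    using assms add_smult[of y "- 1" 1] by simp
  then have "\<ominus> y = (- 1) \<odot> y"
    using assms M.minus_equality by blast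
  then show ?thesis by (simp add: a_minus_def)
qed

lemma nrm_zero [simp]: "nrm E \<zero> = 0"
  by (simp add: nrm_eq_0_iff)

lemma nrm_minus_commute:
  assumes "x \<in> carrier E" "y \<in> carrier E"
  shows "nrm E (x \<ominus> y) = nrm E (y \<ominus> x)"
proof -
  have "(- 1) \<odot> (x \<ominus> y) = (- 1) \<odot> x \<oplus> y"
    using assms by (simp add: minus_eq_smult smult_add smult_smult)
  also have "\<dots> = y \<ominus> x"
    using assms by (simp add: minus_eq_smult M.add.m_comm)
  finally show ?thesis
    using nrm_smult[of "x \<ominus> y" "- 1"] assms by simp
qed

text \<open>Comes from the triangle inequality: 0 is the norm of \<open>x \<ominus> x\<close>, which
  is at most twice the norm of \<open>x\<close>.\<close>

lemma nrm_nonneg [simp]: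
  assumes "x \<in> carrier E"
  shows "0 \<le> nrm E x"
proof -
  have "0 = nrm E (x \<ominus> x)"
    using assms by (simp add: M.r_neg a_minus_def)
  also have "\<dots> \<le> nrm E x + nrm E ((- 1) \<odot> x)"
    using assms by (simp add: minus_eq_smult nrm_triangle)
  finally show ?thesis
    using assms by (simp add: nrm_smult)
qed

lemma minus_add_minus:
  assumes "x \<in> carrier E" "y \<in> carrier E" "z \<in> carrier E"
  shows "(x \<ominus> y) \<oplus> (y \<ominus> z) = x \<ominus> z"
  using assms by (simp add: a_minus_def M.add.m_assoc M.r_neg1)

lemma minus_eq_zero_iff:
  assumes "x \<in> carrier E" "y \<in> carrier E"
  shows "x \<ominus> y = \<zero> \<longleftrightarrow> x = y"
proof
  assume "x \<ominus> y = \<zero>"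
  then have "\<ominus> (\<ominus> y) = x"
    using assms M.minus_equality[of x "\<ominus> y"] by (simp add: a_minus_def)
  then show "x = y" using assms by simp
qed (use assms in \<open>simp add: a_minus_def M.r_neg\<close>)

lemma nrm_minus_triangle:
  assumes "x \<in> carrier E" "y \<in> carrier E" "z \<in> carrier E"
  shows "nrm E (x \<ominus> z) \<le> nrm E (x \<ominus> y) + nrm E (y \<ominus> z)"
  using nrm_triangle[of "x \<ominus> y" "y \<ominus> z"] assms by (simp add: minus_add_minus)

sublocale Metric_space "carrier E" "nrm_dist E"
proof
  show "0 \<le> nrm_dist E x y" for x y
    by (simp add: nrm_dist_def)
  show "nrm_dist E x y = nrm_dist E y x" for x y
    by (simp add: nrm_dist_def nrm_minus_commute)
  show "nrm_dist E x y = 0 \<longleftrightarrow> x = y" if "x \<in> carrier E" "y \<in> carrier E" for x y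
    using that by (simp add: nrm_dist_def nrm_eq_0_iff minus_eq_zero_iff)
  show "nrm_dist E x z \<le> nrm_dist E x y + nrm_dist E y z"
    if "x \<in> carrier E" "y \<in> carrier E" "z \<in> carrier E" for x y z
    using that by (simp add: nrm_dist_def nrm_minus_triangle)
qed

text \<open>Inside the carrier the default branch of \<open>nrm_dist\<close> never applies, so
  metric limits become null sequences of norms.\<close>

lemma limitin_iff_nrm:
  assumes "\<And>n. x n \<in> carrier E"
  shows "limitin mtopology x l sequentially \<longleftrightarrow>
    l \<in> carrier E \<and> (\<lambda>n. nrm E (x n \<ominus> l)) \<longlonglongrightarrow> 0"
  using assms by (auto simp: limitin_metric_dist_null nrm_dist_def)

lemma MCauchy_iff_nrm:
  "MCauchy x \<longleftrightarrow> range x \<subseteq> carrier E \<and>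
    (\<forall>\<epsilon>>0. \<exists>N. \<forall>m n. N \<le> m \<longrightarrow> N \<le> n \<longrightarrow> nrm E (x m \<ominus> x n) < \<epsilon>)"
  unfolding MCauchy_def nrm_dist_def by (rule conj_cong[OF refl]) (simp add: range_subsetD)

lemma banach_spaceI:
  assumes "\<And>x. MCauchy x \<Longrightarrow> \<exists>l\<in>carrier E. (\<lambda>n. nrm E (x n \<ominus> l)) \<longlonglongrightarrow> 0"
  shows "banach_space E"
proof
  show mcomplete
    unfolding mcomplete_def
  proof (intro allI impI)
    fix x assume x: "MCauchy x"
    then have "x n \<in> carrier E" for n
      by (auto simp: MCauchy_def)
    with assms[OF x] show "\<exists>l. limitin mtopology x l sequentially"
      by (auto simp: limitin_iff_nrm)
  qed
qed

end

lemma (in banach_space) MCauchy_convergent: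
  assumes "MCauchy x"
  shows "\<exists>l\<in>carrier E. (\<lambda>n. nrm E (x n \<ominus> l)) \<longlonglongrightarrow> 0"
proof -
  have "x n \<in> carrier E" for n
    using assms by (auto simp: MCauchy_def)
  then show ?thesis
    using complete assms limitin_iff_nrm[of x] unfolding mcomplete_def by blast
qed

text \<open>Additive inverses come from the scalars: \<open>(- 1) \<odot> x\<close> is inverse to
  \<open>x\<close> by distributivity and \<open>0 \<odot> x = \<zero>\<close>. Likewise the norm of
  \<open>\<zero>\<close> vanishes by homogeneity at the scalar 0.\<close>

lemma normed_spaceI:
  fixes E :: "('k::real_normed_field, 'a) normed_module" (structure)
  assumes "\<And>x y. x \<in> carrier E \<Longrightarrow> y \<in> carrier E \<Longrightarrow> x \<oplus> y \<in> carrier E"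
    and "\<zero> \<in> carrier E"
    and "\<And>c x. x \<in> carrier E \<Longrightarrow> c \<odot> x \<in> carrier E"
    and "\<And>x y z. x \<in> carrier E \<Longrightarrow> y \<in> carrier E \<Longrightarrow> z \<in> carrier E
      \<Longrightarrow> (x \<oplus> y) \<oplus> z = x \<oplus> (y \<oplus> z)"
    and "\<And>x y. x \<in> carrier E \<Longrightarrow> y \<in> carrier E \<Longrightarrow> x \<oplus> y = y \<oplus> x"
    and "\<And>x. x \<in> carrier E \<Longrightarrow> \<zero> \<oplus> x = x"
    and zero: "\<And>x. x \<in> carrier E \<Longrightarrow> 0 \<odot> x = \<zero>"
    and distr: "\<And>a b x. x \<in> carrier E \<Longrightarrow> (a + b) \<odot> x = a \<odot> x \<oplus> b \<odot> x"
    and "\<And>a x y. x \<in> carrier E \<Longrightarrow> y \<in> carrier E \<Longrightarrow> a \<odot> (x \<oplus> y) = a \<odot> x \<oplus> a \<odot> y"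
    and "\<And>a b x. x \<in> carrier E \<Longrightarrow> (a * b) \<odot> x = a \<odot> (b \<odot> x)"
    and one: "\<And>x. x \<in> carrier E \<Longrightarrow> 1 \<odot> x = x"
    and "\<And>x. x \<in> carrier E \<Longrightarrow> nrm E x = 0 \<Longrightarrow> x = \<zero>"
    and "\<And>x y. x \<in> carrier E \<Longrightarrow> y \<in> carrier E \<Longrightarrow> nrm E (x \<oplus> y) \<le> nrm E x + nrm E y"
    and nrm: "\<And>c x. x \<in> carrier E \<Longrightarrow> nrm E (c \<odot> x) = norm c * nrm E x"
  shows "normed_space E"
proof (intro normed_space.intro normed_space_axioms.intro moduleI abelian_groupI)
  show "\<exists>y\<in>carrier E. y \<oplus> x = \<zero>" if "x \<in> carrier E" for x
    using distr[OF that, of "- 1" 1] zero[OF that] one[OF that] assms(3)[OF that] by auto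
  show "nrm E x = 0 \<longleftrightarrow> x = \<zero>" if "x \<in> carrier E" for x
    using assms(12)[OF that] nrm[OF assms(2), of 0] zero[OF assms(2)] by auto
  show "cring (ring_of_type_algebra :: 'k ring)" ..
qed (use assms in \<open>auto simp: ring_of_type_algebra_def\<close>)


section \<open>Bounded operators, operator norms and functionals\<close>

locale bounded_op = E: normed_space E + F: normed_space F
  for E :: "('k::real_normed_field, 'a) normed_module"
    and F :: "('k, 'b) normed_module" +
  fixes T :: "'a \<Rightarrow> 'b"
  assumes bounded_operator: "bounded_operator E F T"
begin

lemma closed [simp, intro]: "x \<in> carrier E \<Longrightarrow> T x \<in> carrier F"
  using bounded_operator by (auto simp: bounded_operator_def)

lemma add: "x \<in> carrier E \<Longrightarrow> y \<in> carrier E \<Longrightarrow> T (x \<oplus>\<^bsub>E\<^esub> y) = T x \<oplus>\<^bsub>F\<^esub> T y"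
  using bounded_operator by (auto simp: bounded_operator_def)

lemma smult: "x \<in> carrier E \<Longrightarrow> T (c \<odot>\<^bsub>E\<^esub> x) = c \<odot>\<^bsub>F\<^esub> T x"
  using bounded_operator by (auto simp: bounded_operator_def)

lemma diff: "x \<in> carrier E \<Longrightarrow> y \<in> carrier E \<Longrightarrow> T (x \<ominus>\<^bsub>E\<^esub> y) = T x \<ominus>\<^bsub>F\<^esub> T y"
  by (simp add: E.minus_eq_smult F.minus_eq_smult add smult)

lemma zero [simp]: "T \<zero>\<^bsub>E\<^esub> = \<zero>\<^bsub>F\<^esub>"
  using smult[of "\<zero>\<^bsub>E\<^esub>" 0] by simp

lemma bound: "\<exists>C>0. \<forall>x\<in>carrier E. nrm F (T x) \<le> C * nrm E x"
proof -
  obtain C where C: "\<And>x. x \<in> carrier E \<Longrightarrow> nrm F (T x) \<le> C * nrm E x"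
    using bounded_operator unfolding bounded_operator_def by blast
  \<comment> \<open>The constant is enlarged to a strictly positive one, so that later proofs may
    divide by it and multiply inequalities by it.\<close>
  have "nrm F (T x) \<le> (\<bar>C\<bar> + 1) * nrm E x" if "x \<in> carrier E" for x
    using C[OF that] mult_right_mono[of C "\<bar>C\<bar> + 1" "nrm E x"] E.nrm_nonneg[OF that] by linarith
  then show ?thesis by (intro exI[of _ "\<bar>C\<bar> + 1"]) simp
qed

lemma nrm_le_op_norm_of_le_1:
  assumes "x \<in> carrier E" "nrm E x \<le> 1"
  shows "nrm F (T x) \<le> op_norm E F T"
  unfolding op_norm_def
proof (rule cSUP_upper)
  obtain C where "C > 0" and C: "\<And>x. x \<in> carrier E \<Longrightarrow> nrm F (T x) \<le> C * nrm E x"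
    using bound by blast
  have "nrm F (T x) \<le> C" if "x \<in> carrier E" "nrm E x \<le> 1" for x
    using C[of x] mult_left_mono[of "nrm E x" 1 C] that \<open>C > 0\<close> by (simp add: order_trans)
  then show "bdd_above ((\<lambda>x. nrm F (T x)) ` {x \<in> carrier E. nrm E x \<le> 1})"
    by (intro bdd_aboveI2[of _ _ C]) auto
qed (use assms in simp)

lemma op_norm_nonneg [simp]: "0 \<le> op_norm E F T"
  using nrm_le_op_norm_of_le_1[of "\<zero>\<^bsub>E\<^esub>"] by simp

lemma op_norm_le:
  assumes "\<And>x. x \<in> carrier E \<Longrightarrow> nrm E x \<le> 1 \<Longrightarrow> nrm F (T x) \<le> C"
  shows "op_norm E F T \<le> C"
  unfolding op_norm_def using assms by (intro cSUP_least) (auto intro!: exI[of _ "\<zero>\<^bsub>E\<^esub>"])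

lemma nrm_normalized:
  assumes "x \<in> carrier E" "nrm E x \<noteq> 0"
  shows "nrm E (of_real (inverse (nrm E x)) \<odot>\<^bsub>E\<^esub> x) = 1"
    and "nrm F (T (of_real (inverse (nrm E x)) \<odot>\<^bsub>E\<^esub> x)) = nrm F (T x) / nrm E x"
  using assms by (simp_all add: smult E.nrm_smult F.nrm_smult norm_inverse divide_inverse)

lemma nrm_le_op_norm:
  assumes "x \<in> carrier E"
  shows "nrm F (T x) \<le> op_norm E F T * nrm E x"
proof (cases "nrm E x = 0")
  case True
  then show ?thesis using assms by (simp add: E.nrm_eq_0_iff)
next
  case False
  then have "nrm E x > 0" using assms by (simp add: order_less_le)
  with nrm_le_op_norm_of_le_1[of "of_real (inverse (nrm E x)) \<odot>\<^bsub>E\<^esub> x"] nrm_normalized[OF assms False]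
    assms show ?thesis by (simp add: pos_divide_le_eq)
qed

text \<open>A norming point of the closed ball is as good as one on the sphere. If the operator norm
  is positive, it is at most itself times \<open>nrm E x\<close>, which forces
  \<open>nrm E x = 1\<close>; if it is 0, every unit vector norms \<open>T\<close>. The nonempty
  sphere excludes the zero space, in which no operator attains its norm.\<close>

lemma attains_norm_of_le_1:
  assumes "x \<in> carrier E" "nrm E x \<le> 1" "nrm F (T x) \<ge> op_norm E F T" "unit_sphere E \<noteq> {}"
  shows "attains_norm E F T"
proof (cases "op_norm E F T = 0")
  case True
  obtain y where y: "y \<in> unit_sphere E" using assms(4) by blast
  with nrm_le_op_norm[of y] True have "nrm F (T y) \<le> 0"
    by (simp add: unit_sphere_def)
  with y True show ?thesis
    using F.nrm_nonneg[of "T y"] unfolding attains_norm_def unit_sphere_def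
    by (intro bexI[of _ y]) (simp_all add: antisym)
next
  case False
  then have "op_norm E F T > 0" by (simp add: order_less_le)
  with nrm_le_op_norm[OF assms(1)] assms(3) have "op_norm E F T * 1 \<le> op_norm E F T * nrm E x"
    by linarith
  with \<open>op_norm E F T > 0\<close> have "nrm E x \<ge> 1" by (simp only: mult_le_cancel_left_pos)
  with assms nrm_le_op_norm_of_le_1[OF assms(1,2)] show ?thesis
    by (auto simp: attains_norm_def unit_sphere_def intro!: bexI[of _ x])
qed

end

abbreviation functional :: "('k::real_normed_field, 'a) normed_module \<Rightarrow> ('a \<Rightarrow> 'k) \<Rightarrow> bool" where
  "functional E \<equiv> bounded_operator E scalar_space"

lemma functional_iff:
  "functional E f \<longleftrightarrow>
    (\<forall>x\<in>carrier E. \<forall>y\<in>carrier E. f (x \<oplus>\<^bsub>E\<^esub> y) = f x + f y) \<and>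
    (\<forall>c. \<forall>x\<in>carrier E. f (c \<odot>\<^bsub>E\<^esub> x) = c * f x) \<and>
    (\<exists>C. \<forall>x\<in>carrier E. norm (f x) \<le> C * nrm E x)"
  by (simp add: bounded_operator_def scalar_space_def)

lemma normed_space_scalar_space: "normed_space scalar_space"
  by (rule normed_spaceI)
     (simp_all add: scalar_space_def algebra_simps norm_triangle_ineq norm_mult)

lemma bounded_operator_compose:
  assumes "normed_space E" "normed_space F" "normed_space G"
    and T: "bounded_operator E F T" and S: "bounded_operator F G S"
  shows "bounded_operator E G (\<lambda>x. S (T x))"
proof -
  interpret T: bounded_op E F T using assms by (simp add: bounded_op_def bounded_op_axioms_def)
  interpret S: bounded_op F G S using assms by (simp add: bounded_op_def bounded_op_axioms_def)
  obtain C where C: "C > 0" "\<And>x. x \<in> carrier E \<Longrightarrow> nrm F (T x) \<le> C * nrm E x"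
    using T.bound by blast
  obtain D where D: "D > 0" "\<And>x. x \<in> carrier F \<Longrightarrow> nrm G (S x) \<le> D * nrm F x"
    using S.bound by blast
  have "nrm G (S (T x)) \<le> D * C * nrm E x" if "x \<in> carrier E" for x
    using D(2)[OF T.closed[OF that]] mult_left_mono[OF C(2)[OF that], of D] D(1)
    by (simp add: mult.assoc order_trans)
  then show ?thesis
    unfolding bounded_operator_def using T.add T.smult S.add S.smult by auto
qed

section \<open>Working forms of the weak maximizing property\<close>

text \<open>Failure of weak nullity gives one functional and one \<epsilon> with modulus at least
  \<epsilon> at infinitely many indices. A subsequence makes this hold at every index and is still
  maximizing.\<close>

lemma WMP_I:
  assumes "banach_space E" "banach_space F"
    and attain: "\<And>T f x \<epsilon>. bounded_operator E F T \<Longrightarrow> functional E f \<Longrightarrow>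
      (\<And>n. x n \<in> carrier E) \<Longrightarrow> (\<And>n. nrm E (x n) = 1) \<Longrightarrow>
      (\<lambda>n. nrm F (T (x n))) \<longlonglongrightarrow> op_norm E F T \<Longrightarrow> \<epsilon> > 0 \<Longrightarrow> (\<And>n. \<epsilon> \<le> norm (f (x n))) \<Longrightarrow>
      \<exists>z\<in>carrier E. nrm E z \<le> 1 \<and> op_norm E F T \<le> nrm F (T z)"
  shows "WMP E F"
  unfolding WMP_def
proof (intro conjI allI impI)
  fix T
  assume T: "bounded_operator E F T" and "\<exists>x. maximizing_sequence E F T x \<and> \<not> weakly_null E x"
  then obtain x f where x: "\<And>n. x n \<in> carrier E" "\<And>n. nrm E (x n) = 1"
      "(\<lambda>n. nrm F (T (x n))) \<longlonglongrightarrow> op_norm E F T"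
    and f: "functional E f" "\<not> (\<lambda>n. f (x n)) \<longlonglongrightarrow> 0"
    by (auto simp: maximizing_sequence_def weakly_null_def unit_sphere_def image_subset_iff)
  then obtain \<epsilon> where "\<epsilon> > 0" "\<forall>N. \<exists>n\<ge>N. \<epsilon> \<le> norm (f (x n))"
    by (auto simp: lim_sequentially not_less)
  then have "infinite {n. \<epsilon> \<le> norm (f (x n))}"
    by (simp add: infinite_nat_iff_unbounded_le)
  then obtain r :: "nat \<Rightarrow> nat" where r: "strict_mono r" "\<And>n. r n \<in> {n. \<epsilon> \<le> norm (f (x n))}"
    using infinite_enumerate by blast
  have lim: "(\<lambda>n. nrm F (T (x (r n)))) \<longlonglongrightarrow> op_norm E F T"
    using LIMSEQ_subseq_LIMSEQ[OF x(3) r(1)] by (simp add: o_def)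
  obtain z where z: "z \<in> carrier E" "nrm E z \<le> 1" "op_norm E F T \<le> nrm F (T z)"
    using attain[OF T f(1) x(1) x(2) lim \<open>\<epsilon> > 0\<close>] r(2) by auto
  interpret bounded_op E F T
    using assms T by (simp add: bounded_op_def bounded_op_axioms_def banach_space_def)
  show "attains_norm E F T"
    using attains_norm_of_le_1[OF z] x by (auto simp: unit_sphere_def)
qed (use assms in auto)

text \<open>
  The defining property of the WMP, for sequences that are only asymptotically maximizing after
  normalization and with any upper bound \<open>c\<close> of the operator norm in place of the norm itself.
\<close>

lemma WMP_attains:
  assumes "WMP E F" "bounded_operator E F T" "functional E f"
    and c: "\<And>x. x \<in> carrier E \<Longrightarrow> nrm F (T x) \<le> c * nrm E x"
    and x: "\<And>n. x n \<in> carrier E" "\<And>n. nrm E (x n) \<le> K"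
    and lim: "(\<lambda>n. c * nrm E (x n) - nrm F (T (x n))) \<longlonglongrightarrow> 0"
    and \<epsilon>: "\<epsilon> > 0" "\<And>n. \<epsilon> \<le> norm (f (x n))"
  obtains z where "z \<in> carrier E" "nrm E z = 1" "nrm F (T z) = c"
proof -
  interpret bounded_op E F T
    using assms by (simp add: bounded_op_def bounded_op_axioms_def WMP_def banach_space_def)
  interpret f: bounded_op E scalar_space f
    using assms normed_space_scalar_space
    by (simp add: bounded_op_def bounded_op_axioms_def WMP_def banach_space_def)
  obtain C where "C > 0" and C: "\<And>x. x \<in> carrier E \<Longrightarrow> norm (f x) \<le> C * nrm E x"
    using f.bound by (auto simp: scalar_space_def)
  \<comment> \<open>The functional keeps the norms away from 0: \<epsilon> is at most the modulus of
    \<open>f (x n)\<close>, hence at most \<open>C * nrm E (x n)\<close>. Normalization therefore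
    magnifies the defect by at most \<open>C / \<epsilon>\<close>.\<close>
  have low: "\<epsilon> / C \<le> nrm E (x n)" for n
    using C[OF x(1)[of n]] \<epsilon>(2)[of n] \<open>C > 0\<close> by (simp add: pos_divide_le_eq mult.commute)
  have pos: "nrm E (x n) > 0" for n
    using low[of n] \<epsilon>(1) \<open>C > 0\<close> by (meson divide_pos_pos less_le_trans)
  have "K > 0" using pos[of 0] x(2)[of 0] by linarith
  define z where "z n = of_real (inverse (nrm E (x n))) \<odot>\<^bsub>E\<^esub> x n" for n
  have z: "z n \<in> carrier E" "nrm E (z n) = 1" "nrm F (T (z n)) = nrm F (T (x n)) / nrm E (x n)" for n
    using nrm_normalized[OF x(1), of n] pos[of n] x(1)[of n] by (simp_all add: z_def)
  have "nrm F (T (z n)) \<ge> c - (c * nrm E (x n) - nrm F (T (x n))) * (C / \<epsilon>)" for n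
  proof -
    have "(c * nrm E (x n) - nrm F (T (x n))) / nrm E (x n)
        \<le> (c * nrm E (x n) - nrm F (T (x n))) / (\<epsilon> / C)"
      using c[OF x(1)[of n]] low[of n] \<epsilon>(1) \<open>C > 0\<close> pos[of n] by (intro divide_left_mono) auto
    then show ?thesis using pos[of n] by (simp add: z diff_divide_distrib)
  qed
  moreover have "(\<lambda>n. c - (c * nrm E (x n) - nrm F (T (x n))) * (C / \<epsilon>)) \<longlonglongrightarrow> c - 0 * (C / \<epsilon>)"
    by (intro tendsto_intros lim)
  moreover have "nrm F (T (z n)) \<le> c" for n
    using c[OF z(1)[of n]] z(2)[of n] by simp
  ultimately have lim_z: "(\<lambda>n. nrm F (T (z n))) \<longlonglongrightarrow> c"
    by (intro real_tendsto_sandwich[of _ "\<lambda>n. nrm F (T (z n))" _ "\<lambda>_. c"]) auto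
  \<comment> \<open>So far \<open>c\<close> is only an upper bound; the normalized sequence shows
    that it is sharp.\<close>
  have op: "op_norm E F T = c"
  proof (rule antisym)
    \<comment> \<open>The sign of \<open>c\<close> is read off from the sequence, since
      \<open>c\<close> lies above a norm.\<close>
    have "c \<ge> 0" using \<open>\<And>n. nrm F (T (z n)) \<le> c\<close>[of 0] z(1)[of 0] F.nrm_nonneg[of "T (z 0)"]
      by (meson closed order_trans)
    show "op_norm E F T \<le> c"
    proof (rule op_norm_le)
      fix y assume "y \<in> carrier E" "nrm E y \<le> 1"
      then show "nrm F (T y) \<le> c"
        using c[of y] mult_left_mono[of "nrm E y" 1 c] \<open>c \<ge> 0\<close> by simp
    qed
    show "c \<le> op_norm E F T"
    proof (rule LIMSEQ_le_const2[OF lim_z], intro exI allI impI)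
      show "nrm F (T (z n)) \<le> op_norm E F T" for n
        using nrm_le_op_norm_of_le_1[of "z n"] z(1,2)[of n] by simp
    qed
  qed
  \<comment> \<open>Here the upper bound \<open>K\<close> enters: dividing by norms at most
    \<open>K\<close> leaves the values of \<open>f\<close> with modulus at least
    \<open>\<epsilon> / K\<close>.\<close>
  have "\<not> (\<lambda>n. f (z n)) \<longlonglongrightarrow> 0"
  proof
    assume "(\<lambda>n. f (z n)) \<longlonglongrightarrow> 0"
    then have "\<forall>\<^sub>F n in sequentially. norm (f (z n)) < \<epsilon> / K"
      using \<epsilon>(1) \<open>K > 0\<close> by (auto simp: tendsto_iff)
    then obtain n where n: "norm (f (z n)) < \<epsilon> / K"
      by (auto simp: eventually_sequentially)
    have "norm (f (z n)) = norm (f (x n)) / nrm E (x n)"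
      using f.nrm_normalized(2)[OF x(1), of n] pos[of n] by (simp add: z_def scalar_space_def)
    also have "\<dots> \<ge> \<epsilon> / K"
      using \<epsilon> x(2)[of n] pos[of n] by (intro frac_le) auto
    finally show False using n by simp
  qed
  then have "\<not> weakly_null E z"
    using assms(3) by (auto simp: weakly_null_def)
  moreover have "maximizing_sequence E F T z"
    using lim_z z op by (auto simp: maximizing_sequence_def unit_sphere_def)
  ultimately have "attains_norm E F T"
    using assms(1,2) by (auto simp: WMP_def)
  then show ?thesis
    using that op by (auto simp: attains_norm_def unit_sphere_def)
qed

section \<open>Closed subspaces, as spaces and as codomains\<close>

lemma banach_space_closed_subspace:
  fixes E :: "('k::real_normed_field, 'a) normed_module" (structure)
  assumes "banach_space E" "closed_subspace E M"
  shows "banach_space (E\<lparr>carrier := M\<rparr>)"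
proof -
  interpret banach_space E by fact
  have sub: "submodule M (ring_of_type_algebra :: 'k ring) E"
    and clo: "closedin mtopology M"
    using assms by (auto simp: closed_subspace_def)
  have "M \<subseteq> carrier E"
    using clo closedin_subset by fastforce
  interpret S: normed_space "E\<lparr>carrier := M\<rparr>"
  proof (intro normed_space.intro normed_space_axioms.intro)
    show "module (ring_of_type_algebra :: 'k ring) (E\<lparr>carrier := M\<rparr>)"
      using submodule.submodule_is_module[OF sub] module_axioms by simp
  qed (use \<open>M \<subseteq> carrier E\<close> in \<open>auto simp: nrm_eq_0_iff nrm_smult intro!: nrm_triangle\<close>)
  \<comment> \<open>Additive inverses are chosen within the carrier, so subtraction in the subspace
    is a priori a different function; both agree with
    \<open>x \<oplus> (- 1) \<odot> y\<close>.\<close>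
  have minus: "x \<ominus>\<^bsub>E\<lparr>carrier := M\<rparr>\<^esub> y = x \<ominus> y" if "x \<in> M" "y \<in> M" for x y
    using that \<open>M \<subseteq> carrier E\<close> S.minus_eq_smult[of x y] minus_eq_smult[of x y] by (auto simp: subset_iff)
  show ?thesis
  proof (rule S.banach_spaceI)
    fix x assume x: "S.MCauchy x"
    then have xM: "x n \<in> M" for n
      unfolding S.MCauchy_iff_nrm by auto
    then have xE: "x n \<in> carrier E" for n using \<open>M \<subseteq> carrier E\<close> by auto
    have "MCauchy x"
      using x xE unfolding S.MCauchy_iff_nrm MCauchy_iff_nrm
      by (simp add: minus xM image_subset_iff)
    then obtain l where l: "l \<in> carrier E" "(\<lambda>n. nrm E (x n \<ominus> l)) \<longlonglongrightarrow> 0"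
      using MCauchy_convergent by blast
    then have "limitin mtopology x l sequentially"
      using limitin_iff_nrm[of x] xE by blast
    then have "l \<in> M"
      using clo xM metric_closedin_iff_sequentially_closed[of M] by blast
    with l show "\<exists>l\<in>carrier (E\<lparr>carrier := M\<rparr>).
        (\<lambda>n. nrm (E\<lparr>carrier := M\<rparr>) (x n \<ominus>\<^bsub>E\<lparr>carrier := M\<rparr>\<^esub> l)) \<longlonglongrightarrow> 0"
      by (intro bexI[of _ l]) (simp_all add: minus xM)
  qed
qed

text \<open>Viewing \<open>T\<close> as an operator into the larger space \<open>F\<close> changes
  neither its values' norms nor its operator norm, hence neither its maximizing sequences nor norm
  attainment.\<close>

lemma WMP_closed_subspace_range:
  assumes "WMP E F" "closed_subspace F G"
  shows "WMP E (F\<lparr>carrier := G\<rparr>)"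
proof -
  interpret F: banach_space F using assms(1) by (simp add: WMP_def)
  have "banach_space E" using assms(1) by (simp add: WMP_def)
  have "G \<subseteq> carrier F"
    using assms(2) submodule.axioms(1) subgroup.subset by (fastforce simp: closed_subspace_def)
  show ?thesis
    unfolding WMP_def
  proof (intro conjI allI impI)
    fix T
    assume "bounded_operator E (F\<lparr>carrier := G\<rparr>) T"
      and "\<exists>x. maximizing_sequence E (F\<lparr>carrier := G\<rparr>) T x \<and> \<not> weakly_null E x"
    moreover from this have "bounded_operator E F T"
      using \<open>G \<subseteq> carrier F\<close> by (auto simp: bounded_operator_def)
    moreover have "op_norm E (F\<lparr>carrier := G\<rparr>) T = op_norm E F T"
      by (simp add: op_norm_def)
    ultimately show "attains_norm E (F\<lparr>carrier := G\<rparr>) T"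
      using assms(1) by (simp add: WMP_def attains_norm_def maximizing_sequence_def)
  qed (use \<open>banach_space E\<close> banach_space_closed_subspace[OF F.banach_space_axioms assms(2)] in auto)
qed

section \<open>Metric surjections and 1-complemented subspaces\<close>

text \<open>
  Quotient maps and norm-one projections onto their range are both of this kind, so the two
  halves of part (b) become one.
\<close>

locale metric_surjection = bounded_op E Q q
  for E :: "('k::real_normed_field, 'a) normed_module"
    and Q :: "('k, 'b) normed_module"
    and q :: "'a \<Rightarrow> 'b" +
  assumes nrm_le: "x \<in> carrier E \<Longrightarrow> nrm Q (q x) \<le> nrm E x"
    and lift: "y \<in> carrier Q \<Longrightarrow> e > 0 \<Longrightarrow> \<exists>x\<in>carrier E. q x = y \<and> nrm E x < nrm Q y + e"
begin

text \<open>Near-minimal lifts of a maximizing sequence are asymptotically maximizing for the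
  composite of \<open>T\<close> with \<open>q\<close>, and \<open>f\<close> composed with
  \<open>q\<close> takes on them the values that \<open>f\<close> took before. A norming point of
  the composite is pushed down by \<open>q\<close>, which keeps it in the unit ball.\<close>

lemma WMP_transfer:
  assumes EF: "WMP E F" and Q: "banach_space Q"
  shows "WMP Q F"
proof (rule WMP_I[OF Q])
  show "banach_space F" using EF by (simp add: WMP_def)
  then interpret F': banach_space F .
  fix T f y and \<epsilon> :: real
  assume T: "bounded_operator Q F T" and f: "functional Q f"
    and y: "\<And>n. y n \<in> carrier Q" "\<And>n. nrm Q (y n) = 1"
    and lim: "(\<lambda>n. nrm F (T (y n))) \<longlonglongrightarrow> op_norm Q F T"
    and \<epsilon>: "\<epsilon> > 0" "\<And>n. \<epsilon> \<le> norm (f (y n))"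
  interpret T: bounded_op Q F T
    using T by (simp add: bounded_op_def bounded_op_axioms_def F.normed_space_axioms F'.normed_space_axioms)
  have "\<exists>x\<in>carrier E. q x = y n \<and> nrm E x < 1 + inverse (real (Suc n))" for n
    using lift[OF y(1)[of n], of "inverse (real (Suc n))"] y(2)[of n] by simp
  then obtain x where x: "\<And>n. x n \<in> carrier E" "\<And>n. q (x n) = y n"
      "\<And>n. nrm E (x n) < 1 + inverse (real (Suc n))"
    by metis
  have x_ge: "1 \<le> nrm E (x n)" for n
    using nrm_le[OF x(1)[of n]] x(2) y(2) by simp
  have lim_x: "(\<lambda>n. nrm E (x n)) \<longlonglongrightarrow> 1"
  proof (rule real_tendsto_sandwich[of "\<lambda>_. 1" _ _ "\<lambda>n. 1 + inverse (real (Suc n))"])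
    show "(\<lambda>n. 1 + inverse (real (Suc n))) \<longlonglongrightarrow> 1"
      using tendsto_add[OF tendsto_const[of 1] LIMSEQ_inverse_real_of_nat] by simp
  qed (use x_ge less_imp_le[OF x(3)] in auto)
  have TQ: "bounded_operator E F (\<lambda>x. T (q x))"
    using bounded_operator_compose[of E Q F q T] bounded_operator T
      E.normed_space_axioms F.normed_space_axioms F'.normed_space_axioms by simp
  have fQ: "functional E (\<lambda>x. f (q x))"
    using bounded_operator_compose[of E Q scalar_space q f] bounded_operator f
      E.normed_space_axioms F.normed_space_axioms normed_space_scalar_space by simp
  obtain z where "z \<in> carrier E" "nrm E z = 1" "nrm F (T (q z)) = op_norm Q F T"
  \<comment> \<open>The lifts have norm below \<open>1 + inverse (real (Suc n))\<close>, hence at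
    most 2.\<close>
  proof (rule WMP_attains[OF EF TQ fQ, of "op_norm Q F T" x 2 \<epsilon>])
    show "nrm F (T (q x)) \<le> op_norm Q F T * nrm E x" if "x \<in> carrier E" for x
      using T.nrm_le_op_norm[of "q x"] mult_left_mono[OF nrm_le[OF that], of "op_norm Q F T"] that
      by simp
    show "nrm E (x n) \<le> 2" for n
      using x(3)[of n] inverse_le_1_iff[of "real (Suc n)"] by auto
    show "(\<lambda>n. op_norm Q F T * nrm E (x n) - nrm F (T (q (x n)))) \<longlonglongrightarrow> 0"
      using tendsto_diff[OF tendsto_mult[OF tendsto_const lim_x, of "op_norm Q F T"] lim] x(2) by simp
  qed (use x \<epsilon> in auto)
  then show "\<exists>z\<in>carrier Q. nrm Q z \<le> 1 \<and> op_norm Q F T \<le> nrm F (T z)"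
    using nrm_le[of z] by (intro bexI[of _ "q z"]) auto
qed

text \<open>From a Cauchy sequence in \<open>Q\<close> a rapidly convergent subsequence is taken and
  its increments are lifted with summable norms. The partial sums converge in \<open>E\<close>,
  \<open>q\<close> carries their limit to a limit of the subsequence, and a Cauchy sequence
  converges along with any subsequence.\<close>

lemma banach_space_image:
  assumes "banach_space E"
  shows "banach_space Q"
proof (rule F.banach_spaceI)
  interpret E': banach_space E by fact
  fix y assume cau: "F.MCauchy y"
  then have y: "y n \<in> carrier Q" for n by (auto simp: F.MCauchy_def)
  have "\<exists>N. \<forall>m n. N \<le> m \<longrightarrow> N \<le> n \<longrightarrow> nrm Q (y m \<ominus>\<^bsub>Q\<^esub> y n) < (1/2) ^ k" for k :: nat
    using cau by (simp add: F.MCauchy_iff_nrm)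
  then obtain N where N: "\<And>k m n. N k \<le> m \<Longrightarrow> N k \<le> n \<Longrightarrow> nrm Q (y m \<ominus>\<^bsub>Q\<^esub> y n) < (1/2) ^ k"
    by metis
  \<comment> \<open>Summing the successors makes \<open>r\<close> strictly increasing and at least
    \<open>N k\<close> at \<open>k\<close>, even if \<open>N\<close> is not monotone.\<close>
  define r where "r k = (\<Sum>i\<le>k. Suc (N i))" for k
  have "strict_mono r" by (rule strict_mono_Suc_iff[THEN iffD2]) (simp add: r_def)
  have N_le: "N k \<le> r k" for k
    by (cases k) (simp_all add: r_def)
  then have step: "nrm Q (y (r (Suc k)) \<ominus>\<^bsub>Q\<^esub> y (r k)) < (1/2) ^ k" for k
    using N_le[of k] strict_mono_less_eq[OF \<open>strict_mono r\<close>, of k "Suc k"]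
    by (intro N) (auto intro: order_trans)
  \<comment> \<open>The tolerance for the lift is exactly the room that \<open>step\<close> leaves
    below \<open>(1/2) ^ k\<close>.\<close>
  have "\<exists>u\<in>carrier E. q u = y (r (Suc k)) \<ominus>\<^bsub>Q\<^esub> y (r k) \<and> nrm E u < (1/2) ^ k" for k
    using lift[of "y (r (Suc k)) \<ominus>\<^bsub>Q\<^esub> y (r k)"
        "(1/2) ^ k - nrm Q (y (r (Suc k)) \<ominus>\<^bsub>Q\<^esub> y (r k))"] step[of k] y by simp
  then obtain u where u: "\<And>k. u k \<in> carrier E" "\<And>k. q (u k) = y (r (Suc k)) \<ominus>\<^bsub>Q\<^esub> y (r k)"
      "\<And>k. nrm E (u k) < (1/2) ^ k"
    by metis
  obtain v where v: "v \<in> carrier E" "q v = y (r 0)"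
    using lift[OF y, of 1] by auto
  define x where "x = rec_nat v (\<lambda>k a. u k \<oplus>\<^bsub>E\<^esub> a)"
  have xS: "x 0 = v" "x (Suc k) = u k \<oplus>\<^bsub>E\<^esub> x k" for k
    by (simp_all add: x_def)
  have x: "x k \<in> carrier E" for k
    by (induction k) (simp_all add: xS v u)
  have qx: "q (x k) = y (r k)" for k
  proof (induction k)
    case (Suc k)
    then show ?case
      using y by (simp add: xS add u x a_minus_def F.M.add.m_assoc F.M.l_neg)
  qed (simp add: xS v)
  \<comment> \<open>The right-hand side is the geometric sum of \<open>(1/2) ^ i\<close> for
    \<open>i\<close> from \<open>k\<close> to \<open>k + j - 1\<close>; keeping its exact value lets
    the induction close.\<close>
  have diff_x: "nrm E (x (k + j) \<ominus>\<^bsub>E\<^esub> x k) \<le> 2 * (1/2) ^ k - 2 * (1/2) ^ (k + j)" for k j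
  proof (induction j)
    case (Suc j)
    have "x (k + Suc j) \<ominus>\<^bsub>E\<^esub> x k = u (k + j) \<oplus>\<^bsub>E\<^esub> (x (k + j) \<ominus>\<^bsub>E\<^esub> x k)"
      using x u by (simp add: xS a_minus_def E.M.add.m_assoc)
    then have "nrm E (x (k + Suc j) \<ominus>\<^bsub>E\<^esub> x k) \<le> nrm E (u (k + j)) + nrm E (x (k + j) \<ominus>\<^bsub>E\<^esub> x k)"
      using x u by (simp add: E.nrm_triangle)
    then show ?case using Suc u(3)[of "k + j"] by simp
  qed (use x in \<open>simp add: a_minus_def E.M.r_neg\<close>)
  have le: "nrm E (x m \<ominus>\<^bsub>E\<^esub> x n) \<le> 2 * (1/2) ^ n" if "n \<le> m" for m n
  proof -
    have "nrm E (x m \<ominus>\<^bsub>E\<^esub> x n) \<le> 2 * (1/2) ^ n - 2 * (1/2) ^ m"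
      using diff_x[of n "m - n"] that by simp
    moreover have "(0::real) \<le> 2 * (1/2) ^ m" by simp
    ultimately show ?thesis by linarith
  qed
  have "E.MCauchy x"
    unfolding E.MCauchy_iff_nrm
  proof (intro conjI allI impI)
    fix \<epsilon> :: real assume "\<epsilon> > 0"
    then obtain k where k: "(1/2) ^ k < \<epsilon> / 2"
      using real_arch_pow_inv[of "\<epsilon> / 2" "1/2"] by auto
    have "nrm E (x m \<ominus>\<^bsub>E\<^esub> x n) < \<epsilon>" if "k \<le> n" "n \<le> m" for m n
    proof -
      have "(1/2::real) ^ n \<le> (1/2) ^ k" using that by (intro power_decreasing) auto
      then show ?thesis using le[OF that(2)] k by linarith
    qed
    then have "nrm E (x m \<ominus>\<^bsub>E\<^esub> x n) < \<epsilon>" if "k \<le> m" "k \<le> n" for m n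
      using that E.nrm_minus_commute[OF x x, of m n] by (metis nat_le_linear)
    then show "\<exists>N. \<forall>m n. N \<le> m \<longrightarrow> N \<le> n \<longrightarrow> nrm E (x m \<ominus>\<^bsub>E\<^esub> x n) < \<epsilon>"
      by blast
  qed (use x in auto)
  then obtain l where l: "l \<in> carrier E" "(\<lambda>n. nrm E (x n \<ominus>\<^bsub>E\<^esub> l)) \<longlonglongrightarrow> 0"
    using E'.MCauchy_convergent by blast
  have "(\<lambda>n. nrm Q (y (r n) \<ominus>\<^bsub>Q\<^esub> q l)) \<longlonglongrightarrow> 0"
  proof (rule real_tendsto_sandwich[OF _ _ tendsto_const l(2)])
    show "\<forall>\<^sub>F n in sequentially. nrm Q (y (r n) \<ominus>\<^bsub>Q\<^esub> q l) \<le> nrm E (x n \<ominus>\<^bsub>E\<^esub> l)"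
      using nrm_le[of "x _ \<ominus>\<^bsub>E\<^esub> l"] l(1) x by (simp add: diff qx)
  qed (use y l in simp)
  then have "limitin F.mtopology (y \<circ> r) (q l) sequentially"
    using F.limitin_iff_nrm[of "y \<circ> r"] y l(1) by simp
  then have "limitin F.mtopology y (q l) sequentially"
    using F.MCauchy_convergent_subsequence[OF cau \<open>strict_mono r\<close>] by simp
  then show "\<exists>l\<in>carrier Q. (\<lambda>n. nrm Q (y n \<ominus>\<^bsub>Q\<^esub> l)) \<longlonglongrightarrow> 0"
    using F.limitin_iff_nrm[of y] y by auto
qed

end

text \<open>The projection is a metric surjection onto its range: it does not increase norms, and a
  point of \<open>M\<close> is fixed by \<open>P\<close>, so it is its own lift.\<close>

lemma WMP_one_complemented:
  assumes "WMP E F" "closed_subspace E M" "one_complemented E M"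
  shows "WMP (E\<lparr>carrier := M\<rparr>) F"
proof -
  interpret E: banach_space E using assms(1) by (simp add: WMP_def)
  have banach: "banach_space (E\<lparr>carrier := M\<rparr>)"
    using banach_space_closed_subspace[OF E.banach_space_axioms assms(2)] .
  then interpret M: banach_space "E\<lparr>carrier := M\<rparr>" .
  obtain P where P: "bounded_operator E E P" "\<And>x. x \<in> carrier E \<Longrightarrow> P (P x) = P x"
      "op_norm E E P \<le> 1" "P ` carrier E = M"
    using assms(3) by (auto simp: one_complemented_def)
  interpret P: bounded_op E E P
    by unfold_locales fact
  interpret metric_surjection E "E\<lparr>carrier := M\<rparr>" P
  proof
    show "bounded_operator E (E\<lparr>carrier := M\<rparr>) P"
      using P(1,4) by (auto simp: bounded_operator_def)
    show "nrm (E\<lparr>carrier := M\<rparr>) (P x) \<le> nrm E x" if "x \<in> carrier E" for x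
      using P.nrm_le_op_norm[OF that] mult_right_mono[OF P(3) E.nrm_nonneg[OF that]] by simp
    show "\<exists>x\<in>carrier E. P x = y \<and> nrm E x < nrm (E\<lparr>carrier := M\<rparr>) y + e"
      if "y \<in> carrier (E\<lparr>carrier := M\<rparr>)" "e > 0" for y e
      using that P(2,4) by (intro bexI[of _ y]) auto
  qed
  show ?thesis using WMP_transfer[OF assms(1) banach] .
qed

section \<open>Quotients by closed subspaces\<close>

text \<open>The quotient norm is an infimum over a coset: it is at most the norm of each
  representative, and some representative comes within \<open>e\<close> of it. These two facts give
  the required properties of the quotient map and also the norm axioms; closedness of
  \<open>M\<close> is what makes the norm definite.\<close>

lemma metric_surjection_quotient:
  fixes E :: "('k::real_normed_field, 'a) normed_module" (structure)
  assumes "normed_space E" "closed_subspace E M"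
  shows "metric_surjection E (quotient_space E M) (\<lambda>x. M +> x)"
proof -
  interpret normed_space E by fact
  have sub: "submodule M (ring_of_type_algebra :: 'k ring) E" and clo: "closedin mtopology M"
    using assms by (auto simp: closed_subspace_def)
  interpret abelian_subgroup M E
    using submodule.axioms(1)[OF sub]
    by (intro abelian_subgroupI3 additive_subgroup.intro M.abelian_group_axioms)
  have smult_M: "c \<odot> z \<in> M" if "z \<in> M" for c z
    using submodule.smult_closed[OF sub, of c z] that by (simp add: ring_of_type_algebra_def)
  define Q where "Q = quotient_space E M"
  define q where "q x = M +> x" for x
  \<comment> \<open>A coset is the fibre of \<open>q\<close> through any of its points, so
    membership turns into an equation between values of \<open>q\<close>.\<close>
  have mem: "z \<in> q x \<longleftrightarrow> z \<in> carrier E \<and> q z = q x" if "x \<in> carrier E" for x z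
    using that a_repr_independence'[of z x] a_rcos_self[of z] a_r_coset_subset_G[of M x] a_subset
    unfolding q_def by auto
  have q_eq_iff: "q x = q y \<longleftrightarrow> x \<oplus> \<ominus> y \<in> M" if "x \<in> carrier E" "y \<in> carrier E" for x y
    using a_rcos_module[of y x] mem[of y x] that by (simp add: q_def)
  have carrier_Q: "carrier Q = q ` carrier E"
    by (auto simp: Q_def quotient_space_def A_RCOSETS_def' q_def)
  have zero_Q: "\<zero>\<^bsub>Q\<^esub> = q \<zero>"
    by (simp add: Q_def quotient_space_def q_def a_subset)
  have add_Q: "q x \<oplus>\<^bsub>Q\<^esub> q y = q (x \<oplus> y)" if "x \<in> carrier E" "y \<in> carrier E" for x y
    using a_rcos_sum that by (simp add: Q_def quotient_space_def q_def)
  \<comment> \<open>The union defining the scalar multiple runs over cosets that all coincide,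
    because \<open>c \<odot> (z \<oplus> \<ominus> x)\<close> stays in \<open>M\<close>.\<close>
  have smult_Q: "c \<odot>\<^bsub>Q\<^esub> q x = q (c \<odot> x)" if "x \<in> carrier E" for c x
  proof -
    have "q (c \<odot> z) = q (c \<odot> x)" if "z \<in> q x" for z
    proof -
      have z: "z \<in> carrier E" "z \<oplus> \<ominus> x \<in> M"
        using that \<open>x \<in> carrier E\<close> mem q_eq_iff by auto
      have "c \<odot> z \<oplus> \<ominus> (c \<odot> x) = c \<odot> (z \<oplus> \<ominus> x)"
        using z(1) \<open>x \<in> carrier E\<close> smult_r_minus[of c x]
        by (simp add: smult_add ring_of_type_algebra_def)
      then show ?thesis
        using z \<open>x \<in> carrier E\<close> smult_M by (simp add: q_eq_iff)
    qed
    moreover have "x \<in> q x" using mem[OF that] that by simp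
    ultimately have "(\<Union>z\<in>q x. q (c \<odot> z)) = q (c \<odot> x)" by blast
    then show ?thesis by (simp add: Q_def quotient_space_def q_def)
  qed
  have nrm_Q: "nrm Q A = (INF z\<in>A. nrm E z)" for A
    by (simp add: Q_def quotient_space_def)
  have le: "nrm Q (q x) \<le> nrm E z" if "x \<in> carrier E" "z \<in> carrier E" "q z = q x" for x z
    unfolding nrm_Q
  proof (rule cINF_lower)
    show "bdd_below (nrm E ` q x)"
      using mem[OF that(1)] by (intro bdd_belowI2[of _ 0]) auto
  qed (use mem[OF that(1)] that in auto)
  have nonneg: "0 \<le> nrm Q (q x)" if "x \<in> carrier E" for x
    unfolding nrm_Q using mem[OF that] that by (intro cINF_greatest) auto
  have lift: "\<exists>z\<in>carrier E. q z = q x \<and> nrm E z < nrm Q (q x) + e"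
    if "x \<in> carrier E" "e > 0" for x e
  proof -
    have "\<exists>z\<in>q x. nrm E z < nrm Q (q x) + e"
      using mem[OF that(1)] that unfolding nrm_Q
      by (intro cInf_lessD[of "nrm E ` q x", simplified bex_simps(7)]) auto
    then show ?thesis using mem[OF that(1)] by auto
  qed
  have smult_le: "nrm Q (q (c \<odot> x)) \<le> norm c * nrm Q (q x)" if x: "x \<in> carrier E" for c x
  proof (rule field_le_epsilon)
    fix e :: real assume "e > 0"
    \<comment> \<open>The added 1 keeps the denominator positive when \<open>c = 0\<close>.\<close>
    then have "e / (norm c + 1) > 0" by (simp add: add_nonneg_pos)
    then obtain z where z: "z \<in> carrier E" "q z = q x" "nrm E z < nrm Q (q x) + e / (norm c + 1)"
      using lift[OF x] by blast
    have "q (c \<odot> z) = q (c \<odot> x)" using smult_Q[of z c] smult_Q[of x c] z x by simp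
    then have "nrm Q (q (c \<odot> x)) \<le> norm c * nrm E z"
      using le[of "c \<odot> x" "c \<odot> z"] z x by (simp add: nrm_smult)
    also have "\<dots> \<le> norm c * (nrm Q (q x) + e / (norm c + 1))"
      using z(3) by (intro mult_left_mono) auto
    also have "\<dots> \<le> norm c * nrm Q (q x) + e"
    proof -
      have "norm c * (e / (norm c + 1)) \<le> (norm c + 1) * (e / (norm c + 1))"
        using \<open>e / (norm c + 1) > 0\<close> by (intro mult_right_mono) auto
      also have "\<dots> = e" using norm_ge_zero[of c] by (simp add: add_nonneg_eq_0_iff)
      finally show ?thesis by (simp add: distrib_left)
    qed
    finally show "nrm Q (q (c \<odot> x)) \<le> norm c * nrm Q (q x) + e" .
  qed
  interpret Q: normed_space Q
  \<comment> \<open>Every element of \<open>carrier Q\<close> is replaced by \<open>q\<close> of a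
    representative before the axioms are checked.\<close>
  proof (rule normed_spaceI; (elim imageE[where f = q and A = "carrier E", folded carrier_Q])?)
    show "\<zero>\<^bsub>Q\<^esub> \<in> carrier Q" by (simp add: zero_Q carrier_Q)
  next
    fix A x assume "nrm Q A = 0" and A: "A = q x" and x: "x \<in> carrier E"
    \<comment> \<open>A coset of norm 0 has representatives \<open>z n\<close> tending to 0. Then
      \<open>x \<oplus> \<ominus> z n\<close> lies in \<open>M\<close> and tends to
      \<open>x\<close>, so \<open>x\<close> is in \<open>M\<close> and the coset is zero.\<close>
    have "\<exists>z\<in>carrier E. q z = q x \<and> nrm E z < inverse (real (Suc n))" for n
      using lift[OF x, of "inverse (real (Suc n))"] \<open>nrm Q A = 0\<close> A by simp
    then obtain z where z: "\<And>n. z n \<in> carrier E" "\<And>n. q (z n) = q x"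
        "\<And>n. nrm E (z n) < inverse (real (Suc n))"
      by metis
    have x_z: "x \<oplus> \<ominus> z n \<in> M" for n
      using q_eq_iff[of x "z n"] z x by simp
    have "(x \<oplus> \<ominus> z n) \<ominus> x = \<ominus> z n" for n
      using x z(1)[of n] by (simp add: a_minus_def M.add.m_comm M.r_neg1)
    moreover have "nrm E (\<ominus> z n) = nrm E (z n)" for n
      using nrm_smult[of "z n" "- 1"] minus_eq_smult[of \<zero> "z n"] z(1)[of n] by (simp add: a_minus_def)
    moreover have "(\<lambda>n. nrm E (z n)) \<longlonglongrightarrow> 0"
      by (rule real_tendsto_sandwich[OF _ _ tendsto_const LIMSEQ_inverse_real_of_nat])
         (use z(1) less_imp_le[OF z(3)] in auto)
    ultimately have "limitin mtopology (\<lambda>n. x \<oplus> \<ominus> z n) x sequentially"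
      using x z(1) by (subst limitin_iff_nrm) auto
    then have "x \<in> M"
      using clo x_z metric_closedin_iff_sequentially_closed[of M]
      by (metis (no_types, lifting) image_subsetI)
    then have "q x = q \<zero>"
      using q_eq_iff[of x \<zero>] x by simp
    then show "A = \<zero>\<^bsub>Q\<^esub>" by (simp add: A zero_Q)
  next
    fix A B x y assume [simp]: "A = q x" "B = q y" "x \<in> carrier E" "y \<in> carrier E"
    show "nrm Q (A \<oplus>\<^bsub>Q\<^esub> B) \<le> nrm Q A + nrm Q B"
    proof (rule field_le_epsilon)
      fix e :: real assume "e > 0"
      obtain x' where x': "x' \<in> carrier E" "q x' = q x" "nrm E x' < nrm Q (q x) + e / 2"
        using lift[of x "e / 2"] \<open>e > 0\<close> by auto
      obtain y' where y': "y' \<in> carrier E" "q y' = q y" "nrm E y' < nrm Q (q y) + e / 2"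
        using lift[of y "e / 2"] \<open>e > 0\<close> by auto
      have "A \<oplus>\<^bsub>Q\<^esub> B = q (x' \<oplus> y')" using x' y' add_Q[of x' y'] by simp
      then have "nrm Q (A \<oplus>\<^bsub>Q\<^esub> B) \<le> nrm E x' + nrm E y'"
        using le[of "x' \<oplus> y'" "x' \<oplus> y'"] nrm_triangle[of x' y'] x' y' by simp
      then show "nrm Q (A \<oplus>\<^bsub>Q\<^esub> B) \<le> nrm Q A + nrm Q B + e"
        using x' y' by simp
    qed
  next
    fix A c x assume [simp]: "A = q x" "x \<in> carrier E"
    show "nrm Q (c \<odot>\<^bsub>Q\<^esub> A) = norm c * nrm Q A"
    proof (rule antisym)
      show "nrm Q (c \<odot>\<^bsub>Q\<^esub> A) \<le> norm c * nrm Q A"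
        using smult_le by (simp add: smult_Q)
      show "norm c * nrm Q A \<le> nrm Q (c \<odot>\<^bsub>Q\<^esub> A)"
      proof (cases "c = 0")
        case False
        \<comment> \<open>The reverse inequality is \<open>smult_le\<close> for the scalar
          \<open>inverse c\<close> at the vector \<open>c \<odot> x\<close>.\<close>
        then have "nrm Q A \<le> inverse (norm c) * nrm Q (q (c \<odot> x))"
          using smult_le[of "c \<odot> x" "inverse c"] by (simp add: smult_smult norm_inverse)
        then show ?thesis using False by (simp add: smult_Q field_simps)
      qed (simp add: smult_Q nonneg)
    qed
  qed (auto simp: add_Q smult_Q zero_Q carrier_Q M.a_ac add_smult smult_add smult_smult)
  show "metric_surjection E (quotient_space E M) (\<lambda>x. M +> x)"
    unfolding Q_def[symmetric] q_def[symmetric]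
  proof
    show "bounded_operator E Q q"
      unfolding bounded_operator_def
      using le by (auto simp: carrier_Q add_Q smult_Q intro!: exI[of _ 1])
  qed (use le lift in \<open>auto simp: carrier_Q\<close>)
qed

lemma WMP_quotient_space:
  assumes "WMP E F" "closed_subspace E M"
  shows "WMP (quotient_space E M) F"
proof -
  interpret E: banach_space E using assms(1) by (simp add: WMP_def)
  interpret metric_surjection E "quotient_space E M" "\<lambda>x. M +>\<^bsub>E\<^esub> x"
    by (rule metric_surjection_quotient) (fact E.normed_space_axioms assms(2))+
  show ?thesis
    using WMP_transfer[OF assms(1) banach_space_image[OF E.banach_space_axioms]] .
qed

section \<open>Direct sums and their completeness\<close>

lemma sum_space_simps [simp]:
  "carrier (sum_space \<phi> E F) = carrier E \<times> carrier F"
  "\<zero>\<^bsub>sum_space \<phi> E F\<^esub> = (\<zero>\<^bsub>E\<^esub>, \<zero>\<^bsub>F\<^esub>)"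
  "(x, y) \<oplus>\<^bsub>sum_space \<phi> E F\<^esub> (x', y') = (x \<oplus>\<^bsub>E\<^esub> x', y \<oplus>\<^bsub>F\<^esub> y')"
  "c \<odot>\<^bsub>sum_space \<phi> E F\<^esub> (x, y) = (c \<odot>\<^bsub>E\<^esub> x, c \<odot>\<^bsub>F\<^esub> y)"
  "nrm (sum_space \<phi> E F) (x, y) = \<phi> (nrm E x) (nrm F y)"
  by (simp_all add: sum_space_def)

text \<open>Treats both sums at once. As \<phi> lies between maximum and sum, Cauchy sequences are
  Cauchy in each coordinate and coordinatewise limits are limits in the norm; the lower bound also
  gives definiteness. Monotonicity with subadditivity yields the triangle inequality.\<close>

lemma banach_space_sum_space:
  fixes E :: "('k::real_normed_field, 'a) normed_module"
    and F :: "('k, 'b) normed_module"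
  assumes "banach_space E" "banach_space F"
    and lower: "\<And>a b. 0 \<le> a \<Longrightarrow> 0 \<le> b \<Longrightarrow> max a b \<le> \<phi> a b"
    and upper: "\<And>a b. 0 \<le> a \<Longrightarrow> 0 \<le> b \<Longrightarrow> \<phi> a b \<le> a + b"
    and mono: "\<And>a a' b b'. 0 \<le> a \<Longrightarrow> 0 \<le> b \<Longrightarrow> a \<le> a' \<Longrightarrow> b \<le> b' \<Longrightarrow> \<phi> a b \<le> \<phi> a' b'"
    and subadd: "\<And>a a' b b'. \<phi> (a + a') (b + b') \<le> \<phi> a b + \<phi> a' b'"
    and homog: "\<And>r a b. 0 \<le> r \<Longrightarrow> \<phi> (r * a) (r * b) = r * \<phi> a b"
  shows "banach_space (sum_space \<phi> E F)"
proof -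
  interpret E: banach_space E by fact
  interpret F: banach_space F by fact
  let ?S = "sum_space \<phi> E F"
  interpret S: normed_space ?S
  proof (rule normed_spaceI)
    fix x assume "x \<in> carrier ?S" "nrm ?S x = 0"
    then show "x = \<zero>\<^bsub>?S\<^esub>"
      using lower[of "nrm E (fst x)" "nrm F (snd x)"]
      by (cases x) (auto simp: E.nrm_eq_0_iff[symmetric] F.nrm_eq_0_iff[symmetric] antisym)
  next
    fix x y assume "x \<in> carrier ?S" "y \<in> carrier ?S"
    then show "nrm ?S (x \<oplus>\<^bsub>?S\<^esub> y) \<le> nrm ?S x + nrm ?S y"
      by (cases x; cases y)
         (auto intro!: order_trans[OF mono subadd] E.nrm_triangle F.nrm_triangle)
  qed (auto simp: E.M.add.m_assoc F.M.add.m_assoc E.add_smult F.add_smult E.smult_add F.smult_add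
      E.smult_smult F.smult_smult E.nrm_smult F.nrm_smult homog
      intro: E.M.add.m_comm F.M.add.m_comm)
  have minus: "(x, y) \<ominus>\<^bsub>?S\<^esub> (x', y') = (x \<ominus>\<^bsub>E\<^esub> x', y \<ominus>\<^bsub>F\<^esub> y')"
    if "x \<in> carrier E" "x' \<in> carrier E" "y \<in> carrier F" "y' \<in> carrier F" for x y x' y'
    using that by (simp add: S.minus_eq_smult E.minus_eq_smult F.minus_eq_smult)
  show ?thesis
  proof (rule S.banach_spaceI)
    fix s assume s: "S.MCauchy s"
    define x where "x n = fst (s n)" for n
    define y where "y n = snd (s n)" for n
    have s_eq: "s n = (x n, y n)" for n by (simp add: x_def y_def)
    have "(x n, y n) \<in> carrier ?S" for n
      using s unfolding S.MCauchy_def s_eq by blast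
    then have xy: "x n \<in> carrier E" "y n \<in> carrier F" for n by auto
    have "nrm E (x m \<ominus>\<^bsub>E\<^esub> x n) \<le> nrm ?S (s m \<ominus>\<^bsub>?S\<^esub> s n)"
         "nrm F (y m \<ominus>\<^bsub>F\<^esub> y n) \<le> nrm ?S (s m \<ominus>\<^bsub>?S\<^esub> s n)" for m n
      using lower[of "nrm E (x m \<ominus>\<^bsub>E\<^esub> x n)" "nrm F (y m \<ominus>\<^bsub>F\<^esub> y n)"] xy
      by (simp_all add: s_eq minus)
    then have "E.MCauchy x" "F.MCauchy y"
      using s xy unfolding E.MCauchy_iff_nrm F.MCauchy_iff_nrm S.MCauchy_iff_nrm
      by (meson image_subsetI order_le_less_trans)+
    then obtain l k where l: "l \<in> carrier E" "(\<lambda>n. nrm E (x n \<ominus>\<^bsub>E\<^esub> l)) \<longlonglongrightarrow> 0"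
      and k: "k \<in> carrier F" "(\<lambda>n. nrm F (y n \<ominus>\<^bsub>F\<^esub> k)) \<longlonglongrightarrow> 0"
      using E.MCauchy_convergent F.MCauchy_convergent by metis
    have "(\<lambda>n. nrm ?S (s n \<ominus>\<^bsub>?S\<^esub> (l, k))) \<longlonglongrightarrow> 0"
    proof (rule real_tendsto_sandwich[OF _ _ tendsto_const])
      show "(\<lambda>n. nrm E (x n \<ominus>\<^bsub>E\<^esub> l) + nrm F (y n \<ominus>\<^bsub>F\<^esub> k)) \<longlonglongrightarrow> 0"
        using tendsto_add[OF l(2) k(2)] by simp
      show "\<forall>\<^sub>F n in sequentially. 0 \<le> nrm ?S (s n \<ominus>\<^bsub>?S\<^esub> (l, k))"
        using l(1) k(1) xy by (intro always_eventually allI S.nrm_nonneg) (simp add: s_eq minus)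
      show "\<forall>\<^sub>F n in sequentially.
          nrm ?S (s n \<ominus>\<^bsub>?S\<^esub> (l, k)) \<le> nrm E (x n \<ominus>\<^bsub>E\<^esub> l) + nrm F (y n \<ominus>\<^bsub>F\<^esub> k)"
        using l(1) k(1) xy by (intro always_eventually allI) (simp add: s_eq minus upper)
    qed
    then show "\<exists>l\<in>carrier ?S. (\<lambda>n. nrm ?S (s n \<ominus>\<^bsub>?S\<^esub> l)) \<longlonglongrightarrow> 0"
      using l(1) k(1) by (intro bexI[of _ "(l, k)"]) auto
  qed
qed

lemma banach_space_sum1_space:
  "banach_space E \<Longrightarrow> banach_space F \<Longrightarrow> banach_space (E \<oplus>\<^sub>1 F)"
  by (rule banach_space_sum_space) (auto simp: distrib_left)

lemma banach_space_sum_inf_space: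
  "banach_space E \<Longrightarrow> banach_space F \<Longrightarrow> banach_space (E \<oplus>\<^sub>\<infinity> F)"
  by (rule banach_space_sum_space) (auto simp: max_mult_distrib_left)

text \<open>Infinite pigeonhole: of two sets covering the naturals one is infinite, and its
  increasing enumeration is the subsequence.\<close>

lemma subseq_disj [consumes 1]:
  fixes P Q :: "nat \<Rightarrow> bool"
  assumes "\<forall>n. P n \<or> Q n"
  obtains (1) r :: "nat \<Rightarrow> nat" where "strict_mono r" "\<And>n. P (r n)"
    | (2) r :: "nat \<Rightarrow> nat" where "strict_mono r" "\<And>n. Q (r n)"
proof -
  have "UNIV = {n. P n} \<union> {n. Q n}" using assms by auto
  then have "infinite {n. P n} \<or> infinite {n. Q n}"
    by (metis finite_Un infinite_UNIV_nat)
  then show thesis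
    using 1 2 infinite_enumerate[of "{n. P n}"] infinite_enumerate[of "{n. Q n}"] by auto
qed

section \<open>1-sums in the domain\<close>

text \<open>The summand enters through an isometric embedding \<open>j\<close>, with remainder
  \<open>v n\<close>, so that one argument serves either coordinate. The component
  \<open>u n\<close> need not have norm near 1, but its defect is dominated by that of
  \<open>x n\<close>, and the functional keeps it away from 0 along \<open>r\<close>.\<close>

lemma WMP_attains_summand:
  fixes r :: "nat \<Rightarrow> nat"
  assumes "WMP E' F" and "normed_space E" and T: "bounded_operator E F T" and f: "functional E f"
    and j: "bounded_operator E' E j" "\<And>x. x \<in> carrier E' \<Longrightarrow> nrm E (j x) = nrm E' x"
    and u: "\<And>n. u n \<in> carrier E'" and v: "\<And>n. v n \<in> carrier E"
    and sum: "\<And>n. x n = j (u n) \<oplus>\<^bsub>E\<^esub> v n" "\<And>n. nrm E' (u n) + nrm E (v n) = 1"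
    and lim: "(\<lambda>n. nrm F (T (x n))) \<longlonglongrightarrow> op_norm E F T"
    and \<epsilon>: "\<epsilon> > 0" and r: "strict_mono r" "\<And>n. \<epsilon> \<le> norm (f (j (u (r n))))"
  shows "\<exists>z\<in>carrier E. nrm E z \<le> 1 \<and> op_norm E F T \<le> nrm F (T z)"
proof -
  have norm_sp: "normed_space E'" "normed_space F"
    using assms(1) by (auto simp: WMP_def banach_space_def)
  interpret E: normed_space E by fact
  interpret E': normed_space E' by fact
  interpret T: bounded_op E F T using assms norm_sp by (simp add: bounded_op_def bounded_op_axioms_def)
  interpret j: bounded_op E' E j using assms norm_sp by (simp add: bounded_op_def bounded_op_axioms_def)
  let ?c = "op_norm E F T"
  have Tj: "bounded_operator E' F (\<lambda>x. T (j x))"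
    using bounded_operator_compose[OF norm_sp(1) assms(2) norm_sp(2) j(1) T] .
  have fj: "functional E' (\<lambda>x. f (j x))"
    using bounded_operator_compose[OF norm_sp(1) assms(2) normed_space_scalar_space j(1) f] .
  have le: "nrm F (T (j x)) \<le> ?c * nrm E' x" if "x \<in> carrier E'" for x
    using T.nrm_le_op_norm[of "j x"] j(2) that by simp
  \<comment> \<open>The remainder contributes at most \<open>?c * nrm E (v n)\<close> to the norm of
    \<open>T (x n)\<close>. As the two norms add up to 1, this is exactly the part of
    \<open>?c\<close> not charged to \<open>u n\<close>.\<close>
  have defect: "?c * nrm E' (u n) - nrm F (T (j (u n))) \<le> ?c - nrm F (T (x n))" for n
  proof -
    have "nrm F (T (x n)) \<le> nrm F (T (j (u n))) + nrm F (T (v n))"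
      using u v by (simp add: sum(1) T.add T.F.nrm_triangle)
    also have "nrm F (T (v n)) \<le> ?c * nrm E (v n)"
      using T.nrm_le_op_norm[OF v] .
    also have "nrm E (v n) = 1 - nrm E' (u n)"
      using sum(2)[of n] by simp
    finally show ?thesis by (simp add: algebra_simps)
  qed
  obtain z where z: "z \<in> carrier E'" "nrm E' z = 1" "nrm F (T (j z)) = ?c"
  proof (rule WMP_attains[OF assms(1) Tj fj le, of "u \<circ> r" 1 \<epsilon>])
    show "nrm E' ((u \<circ> r) n) \<le> 1" for n
      using sum(2)[of "r n"] E.nrm_nonneg[OF v, of "r n"] by simp
    show "(\<lambda>n. ?c * nrm E' ((u \<circ> r) n) - nrm F (T (j ((u \<circ> r) n)))) \<longlonglongrightarrow> 0"
    proof (rule real_tendsto_sandwich[OF _ _ tendsto_const])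
      show "(\<lambda>n. ?c - nrm F (T (x (r n)))) \<longlonglongrightarrow> 0"
        using tendsto_diff[OF tendsto_const[of ?c] LIMSEQ_subseq_LIMSEQ[OF lim r(1)]]
        by (simp add: o_def)
    qed (use le u defect in auto)
  qed (use u \<epsilon> r in auto)
  then show ?thesis
    using j(2) by (intro bexI[of _ "j z"]) auto
qed

lemma WMP_sum1_space:
  assumes "WMP E\<^sub>1 F" "WMP E\<^sub>2 F"
  shows "WMP (E\<^sub>1 \<oplus>\<^sub>1 E\<^sub>2) F"
proof (rule WMP_I)
  interpret E\<^sub>1: banach_space E\<^sub>1 using assms by (simp add: WMP_def)
  interpret E\<^sub>2: banach_space E\<^sub>2 using assms by (simp add: WMP_def)
  let ?E = "E\<^sub>1 \<oplus>\<^sub>1 E\<^sub>2"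
  show banach: "banach_space ?E" "banach_space F"
    using assms by (auto simp: WMP_def intro: banach_space_sum1_space)
  interpret E: normed_space ?E
    using banach by (simp add: banach_space_def)
  have j\<^sub>1: "bounded_operator E\<^sub>1 ?E (\<lambda>u. (u, \<zero>\<^bsub>E\<^sub>2\<^esub>))"
    and j\<^sub>2: "bounded_operator E\<^sub>2 ?E (\<lambda>u. (\<zero>\<^bsub>E\<^sub>1\<^esub>, u))"
    using E\<^sub>1.nrm_smult[of "\<zero>\<^bsub>E\<^sub>1\<^esub>"] E\<^sub>2.nrm_smult[of "\<zero>\<^bsub>E\<^sub>2\<^esub>"]
    by (auto simp: bounded_operator_def E\<^sub>1.nrm_eq_0_iff E\<^sub>2.nrm_eq_0_iff intro!: exI[of _ 1])
  fix T f x and \<epsilon> :: real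
  assume T: "bounded_operator ?E F T" and f: "functional ?E f"
    and x: "\<And>n. x n \<in> carrier ?E" "\<And>n. nrm ?E (x n) = 1"
    and lim: "(\<lambda>n. nrm F (T (x n))) \<longlonglongrightarrow> op_norm ?E F T"
    and \<epsilon>: "\<epsilon> > 0" "\<And>n. \<epsilon> \<le> norm (f (x n))"
  define u where "u n = fst (x n)" for n
  define v where "v n = snd (x n)" for n
  have x_eq: "x n = (u n, v n)" for n by (simp add: u_def v_def)
  have uv: "u n \<in> carrier E\<^sub>1" "v n \<in> carrier E\<^sub>2" "nrm E\<^sub>1 (u n) + nrm E\<^sub>2 (v n) = 1" for n
    using x[of n] by (simp_all add: x_eq)
  \<comment> \<open>The value of \<open>f\<close> at \<open>x n\<close> is the sum of its values at
    the two components, so one of them keeps at least half of \<epsilon>.\<close>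
  have "\<forall>n. \<epsilon> / 2 \<le> norm (f (u n, \<zero>\<^bsub>E\<^sub>2\<^esub>)) \<or> \<epsilon> / 2 \<le> norm (f (\<zero>\<^bsub>E\<^sub>1\<^esub>, v n))"
  proof
    fix n
    have "f (x n) = f (u n, \<zero>\<^bsub>E\<^sub>2\<^esub>) + f (\<zero>\<^bsub>E\<^sub>1\<^esub>, v n)"
      using f[unfolded functional_iff, THEN conjunct1, rule_format, of "(u n, \<zero>\<^bsub>E\<^sub>2\<^esub>)" "(\<zero>\<^bsub>E\<^sub>1\<^esub>, v n)"]
        uv[of n] by (simp add: x_eq)
    then show "\<epsilon> / 2 \<le> norm (f (u n, \<zero>\<^bsub>E\<^sub>2\<^esub>)) \<or> \<epsilon> / 2 \<le> norm (f (\<zero>\<^bsub>E\<^sub>1\<^esub>, v n))"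
      using \<epsilon>(2)[of n] norm_triangle_ineq[of "f (u n, \<zero>\<^bsub>E\<^sub>2\<^esub>)" "f (\<zero>\<^bsub>E\<^sub>1\<^esub>, v n)"] by auto
  qed
  then show "\<exists>z\<in>carrier ?E. nrm ?E z \<le> 1 \<and> op_norm ?E F T \<le> nrm F (T z)"
  proof (cases rule: subseq_disj)
    case (1 r)
    show ?thesis
      by (rule WMP_attains_summand[OF assms(1) E.normed_space_axioms T f j\<^sub>1,
            where u = u and v = "\<lambda>n. (\<zero>\<^bsub>E\<^sub>1\<^esub>, v n)" and x = x and r = r and \<epsilon> = "\<epsilon> / 2"])
         (use 1 uv lim \<epsilon>(1) in \<open>simp_all add: x_eq\<close>)
  next
    case (2 r)
    show ?thesis
      by (rule WMP_attains_summand[OF assms(2) E.normed_space_axioms T f j\<^sub>2,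
            where u = v and v = "\<lambda>n. (u n, \<zero>\<^bsub>E\<^sub>2\<^esub>)" and x = x and r = r and \<epsilon> = "\<epsilon> / 2"])
         (use 2 uv lim \<epsilon>(1) in \<open>simp_all add: x_eq add.commute\<close>)
  qed
qed

section \<open>Maximum-norm sums in the codomain\<close>

text \<open>Since \<open>p\<close> does not increase norms, the composite with \<open>T\<close> is
  bounded by \<open>op_norm E F T\<close>, and along \<open>r\<close> no norm is lost, so this bound
  is approached. A point where the composite reaches it also norms \<open>T\<close>.\<close>

lemma WMP_attains_factor:
  fixes r :: "nat \<Rightarrow> nat"
  assumes "WMP E F'" and "normed_space F" and T: "bounded_operator E F T" and f: "functional E f"
    and p: "bounded_operator F F' p" "\<And>y. y \<in> carrier F \<Longrightarrow> nrm F' (p y) \<le> nrm F y"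
    and x: "\<And>n. x n \<in> carrier E" "\<And>n. nrm E (x n) = 1"
    and lim: "(\<lambda>n. nrm F (T (x n))) \<longlonglongrightarrow> op_norm E F T"
    and \<epsilon>: "\<epsilon> > 0" "\<And>n. \<epsilon> \<le> norm (f (x n))"
    and r: "strict_mono r" "\<And>n. nrm F (T (x (r n))) \<le> nrm F' (p (T (x (r n))))"
  shows "\<exists>z\<in>carrier E. nrm E z \<le> 1 \<and> op_norm E F T \<le> nrm F (T z)"
proof -
  have norm_sp: "normed_space E" "normed_space F'"
    using assms(1) by (auto simp: WMP_def banach_space_def)
  interpret T: bounded_op E F T using assms norm_sp by (simp add: bounded_op_def bounded_op_axioms_def)
  have pT: "bounded_operator E F' (\<lambda>x. p (T x))"
    using bounded_operator_compose[OF norm_sp(1) assms(2) norm_sp(2) T p(1)] .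
  have eq: "nrm F' (p (T (x (r n)))) = nrm F (T (x (r n)))" for n
    using r(2)[of n] p(2) x(1) by (simp add: antisym)
  obtain z where z: "z \<in> carrier E" "nrm E z = 1" "nrm F' (p (T z)) = op_norm E F T"
  proof (rule WMP_attains[OF assms(1) pT f, of "op_norm E F T" "x \<circ> r" 1 \<epsilon>])
    show "nrm F' (p (T y)) \<le> op_norm E F T * nrm E y" if "y \<in> carrier E" for y
      using order_trans[OF p(2) T.nrm_le_op_norm] that by simp
    show "(\<lambda>n. op_norm E F T * nrm E ((x \<circ> r) n) - nrm F' (p (T ((x \<circ> r) n)))) \<longlonglongrightarrow> 0"
      using tendsto_diff[OF tendsto_const LIMSEQ_subseq_LIMSEQ[OF lim r(1)], of "op_norm E F T"]
      by (simp add: o_def x eq)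
  qed (use x \<epsilon> in auto)
  then show ?thesis
    using p(2)[of "T z"] by (intro bexI[of _ z]) auto
qed

lemma WMP_sum_inf_space:
  assumes "WMP E F\<^sub>1" "WMP E F\<^sub>2"
  shows "WMP E (F\<^sub>1 \<oplus>\<^sub>\<infinity> F\<^sub>2)"
proof (rule WMP_I)
  let ?F = "F\<^sub>1 \<oplus>\<^sub>\<infinity> F\<^sub>2"
  show banach: "banach_space E" "banach_space ?F"
    using assms by (auto simp: WMP_def intro: banach_space_sum_inf_space)
  interpret F: normed_space ?F
    using banach by (simp add: banach_space_def)
  have p: "bounded_operator ?F F\<^sub>1 fst" "bounded_operator ?F F\<^sub>2 snd"
    by (auto simp: bounded_operator_def intro!: exI[of _ 1])
  fix T f x and \<epsilon> :: real
  assume T: "bounded_operator E ?F T" and f: "functional E f"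
    and x: "\<And>n. x n \<in> carrier E" "\<And>n. nrm E (x n) = 1"
    and lim: "(\<lambda>n. nrm ?F (T (x n))) \<longlonglongrightarrow> op_norm E ?F T"
    and \<epsilon>: "\<epsilon> > 0" "\<And>n. \<epsilon> \<le> norm (f (x n))"
  have nrm_F: "nrm ?F y = max (nrm F\<^sub>1 (fst y)) (nrm F\<^sub>2 (snd y))" for y
    by (cases y) simp
  \<comment> \<open>A maximum equals one of its two arguments, so at each index some coordinate
    carries the whole norm.\<close>
  have "\<forall>n. nrm ?F (T (x n)) \<le> nrm F\<^sub>1 (fst (T (x n))) \<or> nrm ?F (T (x n)) \<le> nrm F\<^sub>2 (snd (T (x n)))"
    by (auto simp: nrm_F)
  then show "\<exists>z\<in>carrier E. nrm E z \<le> 1 \<and> op_norm E ?F T \<le> nrm ?F (T z)"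
  proof (cases rule: subseq_disj)
    case (1 r)
    show ?thesis
      by (rule WMP_attains_factor[OF assms(1) F.normed_space_axioms T f p(1) _ x lim \<epsilon> 1])
         (simp add: nrm_F)
  next
    case (2 r)
    show ?thesis
      by (rule WMP_attains_factor[OF assms(2) F.normed_space_axioms T f p(2) _ x lim \<epsilon> 2])
         (simp add: nrm_F)
  qed
qed

theorem proposition2p2:
  fixes E :: "('k::real_normed_field, 'e) normed_module"
    and F :: "('k, 'f) normed_module"
    and E\<^sub>1 :: "('k, 'e1) normed_module"
    and E\<^sub>2 :: "('k, 'e2) normed_module"
    and F\<^sub>1 :: "('k, 'f1) normed_module"
    and F\<^sub>2 :: "('k, 'f2) normed_module"
  assumes "banach_space E" and "banach_space F"
    and "banach_space E\<^sub>1" and "banach_space E\<^sub>2"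
    and "banach_space F\<^sub>1" and "banach_space F\<^sub>2"
  shows "(WMP E F \<longrightarrow> (\<forall>G. closed_subspace F G \<longrightarrow> WMP E (F\<lparr>carrier := G\<rparr>)))
    \<and> (WMP E F \<longrightarrow>
          (\<forall>M. closed_subspace E M \<longrightarrow> WMP (quotient_space E M) F)
        \<and> (\<forall>M. closed_subspace E M \<and> one_complemented E M \<longrightarrow> WMP (E\<lparr>carrier := M\<rparr>) F))
    \<and> (WMP E\<^sub>1 F \<and> WMP E\<^sub>2 F \<longrightarrow> WMP (E\<^sub>1 \<oplus>\<^sub>1 E\<^sub>2) F)
    \<and> (WMP E F\<^sub>1 \<and> WMP E F\<^sub>2 \<longrightarrow> WMP E (F\<^sub>1 \<oplus>\<^sub>\<infinity> F\<^sub>2))"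
  by (blast intro: WMP_closed_subspace_range WMP_quotient_space WMP_one_complemented
      WMP_sum1_space WMP_sum_inf_space)

end
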